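(* Over a field $F$, the class of finite-dimensional anti-commutative CB-algebras is closed under taking subalgebras, factor algebras and (finite) direct sums.
   Context: An algebra over $F$ is a vector space with a bilinear product (not assumed associative), written by juxtaposition. It is anti-commutative if $x^2=0$ for all $x\in A$. An anti-commutative algebra $A$ is a CB-algebra if, whenever $x,y\in A$ satisfy $xy=0$, then $(xz)y=0$ for all $z\in A$. The paper expresses this closure property by saying that these algebras form a pseudo-variety. *)

theory Defs
  imports "HOL-Algebra.QuotRing" "HOL-Algebra.Module" "HOL-Library.FuncSet"
begin

text \<open>
  An algebra is carried by the \<open>module\<close> record of HOL-Algebra, whose multiplication is not
  constrained by the locale \<^locale>\<open>module\<close>. The field \<open>one\<close> of that record is inherited from
  \<open>monoid\<close> and has no meaning here: no unit element is assumed, and no definition below that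
  states a property refers to it.
\<close>

locale nonassoc_algebra = field F + module F A for F (structure) and A (structure) +
  assumes mult_closed:
      "\<lbrakk>x \<in> carrier A; y \<in> carrier A\<rbrakk> \<Longrightarrow> x \<otimes>\<^bsub>A\<^esub> y \<in> carrier A"
    and mult_add_left:
      "\<lbrakk>x \<in> carrier A; y \<in> carrier A; z \<in> carrier A\<rbrakk>
        \<Longrightarrow> (x \<oplus>\<^bsub>A\<^esub> y) \<otimes>\<^bsub>A\<^esub> z = (x \<otimes>\<^bsub>A\<^esub> z) \<oplus>\<^bsub>A\<^esub> (y \<otimes>\<^bsub>A\<^esub> z)"
    and mult_add_right:
      "\<lbrakk>x \<in> carrier A; y \<in> carrier A; z \<in> carrier A\<rbrakk>
        \<Longrightarrow> x \<otimes>\<^bsub>A\<^esub> (y \<oplus>\<^bsub>A\<^esub> z) = (x \<otimes>\<^bsub>A\<^esub> y) \<oplus>\<^bsub>A\<^esub> (x \<otimes>\<^bsub>A\<^esub> z)"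
    and mult_smult_left:
      "\<lbrakk>a \<in> carrier F; x \<in> carrier A; y \<in> carrier A\<rbrakk>
        \<Longrightarrow> (a \<odot>\<^bsub>A\<^esub> x) \<otimes>\<^bsub>A\<^esub> y = a \<odot>\<^bsub>A\<^esub> (x \<otimes>\<^bsub>A\<^esub> y)"
    and mult_smult_right:
      "\<lbrakk>a \<in> carrier F; x \<in> carrier A; y \<in> carrier A\<rbrakk>
        \<Longrightarrow> x \<otimes>\<^bsub>A\<^esub> (a \<odot>\<^bsub>A\<^esub> y) = a \<odot>\<^bsub>A\<^esub> (x \<otimes>\<^bsub>A\<^esub> y)"

definition is_finite_basis ::
    "('f, 'm) ring_scheme \<Rightarrow> ('f, 'a, 'n) module_scheme \<Rightarrow> 'a set \<Rightarrow> bool" where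
  "is_finite_basis F A B \<longleftrightarrow>
     finite B \<and> B \<subseteq> carrier A \<and>
     (\<forall>c \<in> B \<rightarrow> carrier F.
        (\<Oplus>\<^bsub>A\<^esub>b\<in>B. c b \<odot>\<^bsub>A\<^esub> b) = \<zero>\<^bsub>A\<^esub> \<longrightarrow> (\<forall>b\<in>B. c b = \<zero>\<^bsub>F\<^esub>)) \<and>
     (\<forall>x \<in> carrier A. \<exists>c \<in> B \<rightarrow> carrier F. x = (\<Oplus>\<^bsub>A\<^esub>b\<in>B. c b \<odot>\<^bsub>A\<^esub> b))"

definition finite_dimensional ::
    "('f, 'm) ring_scheme \<Rightarrow> ('f, 'a, 'n) module_scheme \<Rightarrow> bool" where
  "finite_dimensional F A \<longleftrightarrow> (\<exists>B. is_finite_basis F A B)"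

definition anticommutative :: "('f, 'a, 'n) module_scheme \<Rightarrow> bool" where
  "anticommutative A \<longleftrightarrow> (\<forall>x \<in> carrier A. x \<otimes>\<^bsub>A\<^esub> x = \<zero>\<^bsub>A\<^esub>)"

definition CB_property :: "('f, 'a, 'n) module_scheme \<Rightarrow> bool" where
  "CB_property A \<longleftrightarrow>
     (\<forall>x \<in> carrier A. \<forall>y \<in> carrier A. x \<otimes>\<^bsub>A\<^esub> y = \<zero>\<^bsub>A\<^esub> \<longrightarrow>
        (\<forall>z \<in> carrier A. (x \<otimes>\<^bsub>A\<^esub> z) \<otimes>\<^bsub>A\<^esub> y = \<zero>\<^bsub>A\<^esub>))"

definition fd_CB_algebra ::
    "('f, 'm) ring_scheme \<Rightarrow> ('f, 'a, 'n) module_scheme \<Rightarrow> bool" where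
  "fd_CB_algebra F A \<longleftrightarrow>
     nonassoc_algebra F A \<and> finite_dimensional F A \<and> anticommutative A \<and> CB_property A"

definition nonassoc_subalgebra ::
    "'a set \<Rightarrow> ('f, 'm) ring_scheme \<Rightarrow> ('f, 'a, 'n) module_scheme \<Rightarrow> bool" where
  "nonassoc_subalgebra S F A \<longleftrightarrow>
     submodule S F A \<and> (\<forall>x \<in> S. \<forall>y \<in> S. x \<otimes>\<^bsub>A\<^esub> y \<in> S)"

definition nonassoc_ideal ::
    "'a set \<Rightarrow> ('f, 'm) ring_scheme \<Rightarrow> ('f, 'a, 'n) module_scheme \<Rightarrow> bool" where
  "nonassoc_ideal I F A \<longleftrightarrow>
     submodule I F A \<and>
     (\<forall>x \<in> carrier A. \<forall>u \<in> I. x \<otimes>\<^bsub>A\<^esub> u \<in> I \<and> u \<otimes>\<^bsub>A\<^esub> x \<in> I)"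

text \<open>
  The operations on cosets follow those of \<^const>\<open>FactRing\<close>. The scalar multiple of a coset is
  written as \<open>\<Union>x\<in>X. I +> a x\<close> rather than as the image of \<open>X\<close>, so that \<open>0 X\<close> is the coset \<open>I\<close>.
\<close>

definition factor_algebra ::
    "('f, 'a, 'n) module_scheme \<Rightarrow> 'a set \<Rightarrow> ('f, 'a set) module" where
  "factor_algebra A I =
     \<lparr>carrier = a_rcosets\<^bsub>A\<^esub> I,
      mult = rcoset_mult A I,
      one = I +>\<^bsub>A\<^esub> \<one>\<^bsub>A\<^esub>,
      zero = I,
      add = set_add A,
      smult = (\<lambda>a X. \<Union>x\<in>X. I +>\<^bsub>A\<^esub> (a \<odot>\<^bsub>A\<^esub> x))\<rparr>"

text \<open>
  For a finite index set the direct sum is the full product. The summands of an indexed family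
  share one element type, so the binary direct sum is also defined, for two different ones.
\<close>

definition direct_sum_algebra ::
    "'i set \<Rightarrow> ('i \<Rightarrow> ('f, 'a, 'n) module_scheme) \<Rightarrow> ('f, 'i \<Rightarrow> 'a) module" where
  "direct_sum_algebra J A =
     \<lparr>carrier = (\<Pi>\<^sub>E i\<in>J. carrier (A i)),
      mult = (\<lambda>x y. \<lambda>i\<in>J. x i \<otimes>\<^bsub>A i\<^esub> y i),
      one = (\<lambda>i\<in>J. \<one>\<^bsub>A i\<^esub>),
      zero = (\<lambda>i\<in>J. \<zero>\<^bsub>A i\<^esub>),
      add = (\<lambda>x y. \<lambda>i\<in>J. x i \<oplus>\<^bsub>A i\<^esub> y i),
      smult = (\<lambda>a x. \<lambda>i\<in>J. a \<odot>\<^bsub>A i\<^esub> x i)\<rparr>"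

definition direct_sum2_algebra ::
    "('f, 'a, 'n) module_scheme \<Rightarrow> ('f, 'b, 'k) module_scheme \<Rightarrow> ('f, 'a \<times> 'b) module" where
  "direct_sum2_algebra A B =
     \<lparr>carrier = carrier A \<times> carrier B,
      mult = (\<lambda>x y. (fst x \<otimes>\<^bsub>A\<^esub> fst y, snd x \<otimes>\<^bsub>B\<^esub> snd y)),
      one = (\<one>\<^bsub>A\<^esub>, \<one>\<^bsub>B\<^esub>),
      zero = (\<zero>\<^bsub>A\<^esub>, \<zero>\<^bsub>B\<^esub>),
      add = (\<lambda>x y. (fst x \<oplus>\<^bsub>A\<^esub> fst y, snd x \<oplus>\<^bsub>B\<^esub> snd y)),
      smult = (\<lambda>a x. (a \<odot>\<^bsub>A\<^esub> fst x, a \<odot>\<^bsub>B\<^esub> snd x))\<rparr>"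

end

theory Submission
  imports Defs
begin

text \<open>
  Linearizing \<open>x x = 0\<close> and \<open>(x z) x = 0\<close> shows that in an anti-commutative algebra the CB property
  is equivalent to the identity \<open>(x z) x = 0\<close>: the property with \<open>y = x\<close> gives the identity, and the
  identity makes \<open>(x y) z\<close> alternating, so that \<open>x y = 0\<close> forces \<open>(x z) y = 0\<close>. Identities pass to
  subalgebras, homomorphic images and direct sums. Finite dimension is handled through finite
  spanning sets, from which every submodule obtains a finite basis by adjoining at most one vector
  for each spanning vector.
\<close>

section \<open>Submodules, spans and finite sums\<close>

locale linear_space = field F + module F A for F (structure) and A (structure)

sublocale nonassoc_algebra \<subseteq> linear_space ..

text \<open>Taking the intersection of submodules instead of linear combinations makes minimality
  the working principle: a property holds on the whole span once it holds on \<open>B\<close> and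
  cuts out a submodule. If \<open>B\<close> leaves the carrier, no submodule contains it and the
  intersection is \<open>UNIV\<close>, hence the recurring condition
  \<open>B \<subseteq> carrier M\<close>.\<close>

definition lin_span ::
    "('f, 'm) ring_scheme \<Rightarrow> ('f, 'a, 'n) module_scheme \<Rightarrow> 'a set \<Rightarrow> 'a set" where
  "lin_span F A B = \<Inter>{S. submodule S F A \<and> B \<subseteq> S}"

context module
begin

lemma submodule_zero_closed: "submodule S R M \<Longrightarrow> \<zero>\<^bsub>M\<^esub> \<in> S"
  using submodule.axioms(1) subgroup.one_closed by fastforce

text \<open>Cited by position below: (1) membership in the carrier, (2) zero, (3) negation, (4)
  scalar multiples, (5) sums.\<close>

lemmas submodule_closed =
  submoduleE(1)[THEN subsetD] submodule_zero_closed submoduleE(3-5)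

text \<open>Negation is multiplication by the scalar \<open>\<ominus> \<one>\<close>, so closure
  under it comes from closure under scalars.\<close>

lemma submoduleI_smult:
  assumes "H \<subseteq> carrier M" "\<zero>\<^bsub>M\<^esub> \<in> H"
    and "\<And>x y. \<lbrakk>x \<in> H; y \<in> H\<rbrakk> \<Longrightarrow> x \<oplus>\<^bsub>M\<^esub> y \<in> H"
    and smult: "\<And>a x. \<lbrakk>a \<in> carrier R; x \<in> H\<rbrakk> \<Longrightarrow> a \<odot>\<^bsub>M\<^esub> x \<in> H"
  shows "submodule H R M"
proof (rule submoduleI)
  show "\<ominus>\<^bsub>M\<^esub> x \<in> H" if "x \<in> H" for x
    using smult[of "\<ominus> \<one>" x] that assms(1) by (auto simp: smult_l_minus)
qed (use assms in auto)

lemma submodule_Int: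
  assumes "submodule S R M" "submodule T R M"
  shows "submodule (S \<inter> T) R M"
  using assms by (intro submoduleI_smult) (auto intro: submodule_closed)

lemma submodule_lin_span:
  assumes "B \<subseteq> carrier M"
  shows "submodule (lin_span R M B) R M"
proof (rule submoduleI_smult)
  show "lin_span R M B \<subseteq> carrier M"
    using assms carrier_is_submodule unfolding lin_span_def by blast
qed (auto simp: lin_span_def intro: submodule_closed)

lemma lin_span_superset: "B \<subseteq> lin_span R M B"
  unfolding lin_span_def by blast

lemma lin_span_least: "submodule S R M \<Longrightarrow> B \<subseteq> S \<Longrightarrow> lin_span R M B \<subseteq> S"
  unfolding lin_span_def by blast

lemma finsum_mem_submodule:
  assumes "submodule S R M" "f \<in> C \<rightarrow> S"
  shows "(\<Oplus>\<^bsub>M\<^esub>b\<in>C. f b) \<in> S"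
proof (cases "finite C")
  case True
  then show ?thesis using assms(2)
  proof (induction C)
    case (insert b C)
    have "f \<in> C \<rightarrow> carrier M" "f b \<in> carrier M"
      using insert.prems submoduleE(1)[OF assms(1)] by auto
    then show ?case using insert by (auto intro: submodule_closed(5)[OF assms(1)])
  qed (simp add: submodule_zero_closed[OF assms(1)])
\<comment> \<open>Over an infinite index set \<open>finsum\<close> takes the default value
  zero.\<close>
qed (simp add: M.finsum_infinite submodule_zero_closed[OF assms(1)])

text \<open>The fold behind \<open>finsum\<close> depends on the carrier, so replacing the carrier
  by \<open>S\<close> is not a mere unfolding. Induction works because every partial sum stays in
  \<open>S\<close>.\<close>

lemma finsum_submodule:
  assumes "submodule S R M" "f \<in> C \<rightarrow> S"
  shows "finsum (M\<lparr>carrier := S\<rparr>) f C = finsum M f C"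
proof -
  interpret S: module R "M\<lparr>carrier := S\<rparr>"
    by (rule submodule.submodule_is_module[OF assms(1) module_axioms])
  show ?thesis
  proof (cases "finite C")
    case True
    then show ?thesis using assms(2)
    proof (induction C)
      case (insert b C)
      have "f \<in> C \<rightarrow> carrier M" "f b \<in> carrier M"
        using insert.prems submoduleE(1)[OF assms(1)] by auto
      then show ?case using insert by (subst S.finsum_insert) auto
    qed simp
  qed (simp add: M.finsum_infinite S.M.finsum_infinite)
qed

text \<open>Expresses bases of a subspace through sums in the ambient space, so that sums belonging
  to different subspaces can be compared.\<close>

lemma is_finite_basis_submodule_iff:
  assumes "submodule S R M"
  shows "is_finite_basis R (M\<lparr>carrier := S\<rparr>) C \<longleftrightarrow>
     finite C \<and> C \<subseteq> S \<and>
     (\<forall>c \<in> C \<rightarrow> carrier R.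
        (\<Oplus>\<^bsub>M\<^esub>b\<in>C. c b \<odot>\<^bsub>M\<^esub> b) = \<zero>\<^bsub>M\<^esub> \<longrightarrow> (\<forall>b\<in>C. c b = \<zero>\<^bsub>R\<^esub>)) \<and>
     (\<forall>x \<in> S. \<exists>c \<in> C \<rightarrow> carrier R. x = (\<Oplus>\<^bsub>M\<^esub>b\<in>C. c b \<odot>\<^bsub>M\<^esub> b))"
proof (cases "C \<subseteq> S")
  case True
  have "finsum (M\<lparr>carrier := S\<rparr>) (\<lambda>b. c b \<odot>\<^bsub>M\<^esub> b) C = (\<Oplus>\<^bsub>M\<^esub>b\<in>C. c b \<odot>\<^bsub>M\<^esub> b)"
    if "c \<in> C \<rightarrow> carrier R" for c
    using that True by (intro finsum_submodule[OF assms]) (auto intro: submodule_closed(4)[OF assms])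
  then show ?thesis unfolding is_finite_basis_def by simp
qed (simp add: is_finite_basis_def)

lemma lin_span_finite_basis:
  assumes "is_finite_basis R M B"
  shows "lin_span R M B = carrier M"
proof
  have B: "B \<subseteq> carrier M" using assms by (simp add: is_finite_basis_def)
  note span = submodule_lin_span[OF B]
  show "lin_span R M B \<subseteq> carrier M" using submoduleE(1)[OF span] .
  show "carrier M \<subseteq> lin_span R M B"
  proof
    fix x assume "x \<in> carrier M"
    then obtain c where c: "c \<in> B \<rightarrow> carrier R" "x = (\<Oplus>\<^bsub>M\<^esub>b\<in>B. c b \<odot>\<^bsub>M\<^esub> b)"
      using assms unfolding is_finite_basis_def by blast
    show "x \<in> lin_span R M B"
      unfolding c(2) using c(1) lin_span_superset[of B]
      by (intro finsum_mem_submodule[OF span]) (auto intro: submodule_closed(4)[OF span])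
  qed
qed

text \<open>The set on the right is itself a submodule containing \<open>b\<close> and
  \<open>B\<close>, so minimality of the span applies. The inclusion serves to read off a
  coefficient of \<open>b\<close>.\<close>

lemma lin_span_insert:
  assumes "b \<in> carrier M" "B \<subseteq> carrier M"
  shows "lin_span R M (insert b B) \<subseteq> {a \<odot>\<^bsub>M\<^esub> b \<oplus>\<^bsub>M\<^esub> t | a t. a \<in> carrier R \<and> t \<in> lin_span R M B}"
    (is "_ \<subseteq> ?S")
proof (rule lin_span_least)
  note span = submodule_lin_span[OF assms(2)]
  note cl = submodule_closed[OF span]
  show "submodule ?S R M"
  proof (rule submoduleI_smult)
    show "?S \<subseteq> carrier M" using assms(1) submoduleE(1)[OF span] by blast
    show "\<zero>\<^bsub>M\<^esub> \<in> ?S"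
      using assms(1) by (intro CollectI exI[of _ "\<zero>"] exI[of _ "\<zero>\<^bsub>M\<^esub>"]) (simp add: cl(2))
    show "x \<oplus>\<^bsub>M\<^esub> y \<in> ?S" if xS: "x \<in> ?S" and yS: "y \<in> ?S" for x y
    proof -
      obtain a t where x: "a \<in> carrier R" "t \<in> lin_span R M B" "x = a \<odot>\<^bsub>M\<^esub> b \<oplus>\<^bsub>M\<^esub> t"
        using xS by blast
      obtain a' t' where y: "a' \<in> carrier R" "t' \<in> lin_span R M B" "y = a' \<odot>\<^bsub>M\<^esub> b \<oplus>\<^bsub>M\<^esub> t'"
        using yS by blast
      show ?thesis using assms(1) x y
        by (intro CollectI exI[of _ "a \<oplus> a'"] exI[of _ "t \<oplus>\<^bsub>M\<^esub> t'"]) (simp add: cl M.a_ac smult_l_distr)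
    qed
    show "d \<odot>\<^bsub>M\<^esub> x \<in> ?S" if d: "d \<in> carrier R" and xS: "x \<in> ?S" for d x
    proof -
      obtain a t where "a \<in> carrier R" "t \<in> lin_span R M B" "x = a \<odot>\<^bsub>M\<^esub> b \<oplus>\<^bsub>M\<^esub> t"
        using xS by blast
      then show ?thesis using assms(1) d
        by (intro CollectI exI[of _ "d \<otimes> a"] exI[of _ "d \<odot>\<^bsub>M\<^esub> t"]) (simp add: cl smult_assoc1 smult_r_distr)
    qed
  qed
  show "insert b B \<subseteq> ?S"
  proof
    fix x assume x: "x \<in> insert b B"
    show "x \<in> ?S"
    proof (cases "x = b")
      case True
      then show ?thesis using assms(1)
        by (intro CollectI exI[of _ "\<one>"] exI[of _ "\<zero>\<^bsub>M\<^esub>"]) (simp add: cl(2))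
    next
      case False
      then show ?thesis using x assms lin_span_superset[of B]
        by (intro CollectI exI[of _ "\<zero>"] exI[of _ x]) auto
    qed
  qed
qed

end

section \<open>Finite bases of subspaces over a field\<close>

context linear_space
begin

text \<open>A nonzero scalar is invertible in a field, and multiplying by its inverse stays in
  \<open>S\<close>.\<close>

lemma submodule_smult_cancel:
  assumes "submodule S F A" "a \<in> carrier F" "a \<noteq> \<zero>\<^bsub>F\<^esub>" "x \<in> carrier A" "a \<odot>\<^bsub>A\<^esub> x \<in> S"
  shows "x \<in> S"
proof -
  have a: "a \<in> Units F" using assms field_Units by auto
  have "inv a \<odot>\<^bsub>A\<^esub> (a \<odot>\<^bsub>A\<^esub> x) = x"
    using a assms by (simp add: smult_assoc1[symmetric])
  then show ?thesis using submodule_closed(4)[OF assms(1) Units_inv_closed[OF a] assms(5)] by simp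
qed

text \<open>Induction on \<open>B\<close> with \<open>S\<close> arbitrary. Let \<open>T\<close> be
  the part of \<open>S\<close> inside the span of \<open>B\<close>. By induction \<open>T\<close>
  has a finite basis, and \<open>S\<close> modulo \<open>T\<close> embeds into the span of
  \<open>insert b B\<close> modulo the span of \<open>B\<close>, which has dimension at most one; so
  at most one further vector completes the basis.\<close>

lemma submodule_finite_basis:
  assumes "finite B" "B \<subseteq> carrier A" "submodule S F A" "S \<subseteq> lin_span F A B"
  shows "\<exists>C. is_finite_basis F (A\<lparr>carrier := S\<rparr>) C"
  using assms
proof (induction B arbitrary: S)
  case empty
  have "submodule {\<zero>\<^bsub>A\<^esub>} F A" by (rule submoduleI_smult) auto
  then have "S \<subseteq> {\<zero>\<^bsub>A\<^esub>}" using lin_span_least[of "{\<zero>\<^bsub>A\<^esub>}" "{}"] empty by auto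
  then show ?case
    by (intro exI[of _ "{}"]) (auto simp: is_finite_basis_submodule_iff[OF empty(2)])
next
  case (insert b B)
  have B: "B \<subseteq> carrier A" and b: "b \<in> carrier A" using insert.prems by auto
  note span = submodule_lin_span[OF B] and S = insert.prems(2)
  note span_closed = submodule_closed[OF span] and S_closed = submodule_closed[OF S]
  show ?case
  proof (cases "S \<subseteq> lin_span F A B")
    case True
    then show ?thesis using insert.IH[OF B S] by blast
  next
    case False
    \<comment> \<open>\<open>s\<close> is the one new basis vector.\<close>
    then obtain s where s: "s \<in> S" "s \<notin> lin_span F A B" by blast
    have sA: "s \<in> carrier A" using S_closed(1)[OF s(1)] .
    let ?T = "S \<inter> lin_span F A B"
    have T: "submodule ?T F A" by (rule submodule_Int[OF S span])
    obtain C where "is_finite_basis F (A\<lparr>carrier := ?T\<rparr>) C" using insert.IH[OF B T] by blast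
    then have C: "finite C" "C \<subseteq> ?T"
      and ind: "\<And>c. c \<in> C \<rightarrow> carrier F \<Longrightarrow> (\<Oplus>\<^bsub>A\<^esub>b\<in>C. c b \<odot>\<^bsub>A\<^esub> b) = \<zero>\<^bsub>A\<^esub> \<Longrightarrow> \<forall>b\<in>C. c b = \<zero>"
      and gen: "\<And>x. x \<in> ?T \<Longrightarrow> \<exists>c \<in> C \<rightarrow> carrier F. x = (\<Oplus>\<^bsub>A\<^esub>b\<in>C. c b \<odot>\<^bsub>A\<^esub> b)"
      unfolding is_finite_basis_submodule_iff[OF T] by blast+
    have sC: "s \<notin> C" using C(2) s(2) by blast
    have CA: "C \<subseteq> carrier A" using C(2) S_closed(1) by blast
    have sum_insert: "(\<Oplus>\<^bsub>A\<^esub>b\<in>insert s C. c b \<odot>\<^bsub>A\<^esub> b) = c s \<odot>\<^bsub>A\<^esub> s \<oplus>\<^bsub>A\<^esub> (\<Oplus>\<^bsub>A\<^esub>b\<in>C. c b \<odot>\<^bsub>A\<^esub> b)"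
      if "c \<in> insert s C \<rightarrow> carrier F" for c
      using that C(1) CA sC sA by (intro M.finsum_insert) auto
    obtain a t where at: "a \<in> carrier F" "t \<in> lin_span F A B" "s = a \<odot>\<^bsub>A\<^esub> b \<oplus>\<^bsub>A\<^esub> t"
      using lin_span_insert[OF b B] s(1) insert.prems(3) by blast
    \<comment> \<open>If \<open>a\<close> were zero, then \<open>s = t\<close> would lie in the span
      of \<open>B\<close>.\<close>
    have "a \<noteq> \<zero>" using at s(2) b by (auto simp: span_closed(1))
    then have aU: "a \<in> Units F" using at(1) field_Units by auto
    have split: "\<exists>d \<in> carrier F. \<exists>y \<in> ?T. x = d \<odot>\<^bsub>A\<^esub> s \<oplus>\<^bsub>A\<^esub> y" if x: "x \<in> S" for x
    proof -
      obtain a' t' where at': "a' \<in> carrier F" "t' \<in> lin_span F A B" "x = a' \<odot>\<^bsub>A\<^esub> b \<oplus>\<^bsub>A\<^esub> t'"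
        using lin_span_insert[OF b B] x insert.prems(3) by blast
      \<comment> \<open>\<open>d\<close> is the ratio of the \<open>b\<close>-coefficients of
        \<open>x\<close> and \<open>s\<close>: subtracting \<open>d\<close> times \<open>s\<close>
        from \<open>x\<close> cancels \<open>b\<close> and leaves \<open>y\<close> in the span of
        \<open>B\<close>.\<close>
      define d where "d = a' \<otimes> inv a"
      have d: "d \<in> carrier F" "d \<otimes> a = a'"
        using aU at(1) at'(1) by (simp_all add: d_def m_assoc)
      define y where "y = t' \<oplus>\<^bsub>A\<^esub> \<ominus>\<^bsub>A\<^esub> (d \<odot>\<^bsub>A\<^esub> t)"
      have tA: "t \<in> carrier A" "t' \<in> carrier A" using at(2) at'(2) span_closed(1) by blast+
      have xA: "x \<in> carrier A" using S_closed(1)[OF x] .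
      have ds: "d \<odot>\<^bsub>A\<^esub> s = a' \<odot>\<^bsub>A\<^esub> b \<oplus>\<^bsub>A\<^esub> d \<odot>\<^bsub>A\<^esub> t"
        using d at(1) b tA by (simp add: at(3) smult_r_distr smult_assoc1[symmetric])
      have yA: "y \<in> carrier A" unfolding y_def using tA d by simp
      have "d \<odot>\<^bsub>A\<^esub> t \<oplus>\<^bsub>A\<^esub> y = t'"
        unfolding y_def using tA d(1) by (simp add: M.a_lcomm[of _ t'] M.r_neg)
      then have eq: "x = d \<odot>\<^bsub>A\<^esub> s \<oplus>\<^bsub>A\<^esub> y"
        unfolding ds at'(3) using at'(1) b tA d(1) yA by (simp add: M.a_assoc)
      have "y \<in> lin_span F A B" unfolding y_def using at(2) at'(2) d(1) by (intro span_closed(3-5))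
      \<comment> \<open>The same \<open>y\<close> is \<open>x\<close> minus \<open>d\<close> times
        \<open>s\<close>, hence lies in \<open>S\<close> as well.\<close>
      moreover have "y = \<ominus>\<^bsub>A\<^esub> (d \<odot>\<^bsub>A\<^esub> s) \<oplus>\<^bsub>A\<^esub> x"
        unfolding eq using sA d(1) yA by (simp add: M.r_neg1)
      then have "y \<in> S" using x s(1) d(1) by (simp add: S_closed(3-5))
      ultimately show ?thesis using eq d(1) by blast
    qed
    have "is_finite_basis F (A\<lparr>carrier := S\<rparr>) (insert s C)"
      unfolding is_finite_basis_submodule_iff[OF S]
    proof (intro conjI ballI impI)
      show "finite (insert s C)" "insert s C \<subseteq> S" using C s(1) by auto
    next
      fix c v
      assume c: "c \<in> insert s C \<rightarrow> carrier F"
        and 0: "(\<Oplus>\<^bsub>A\<^esub>b\<in>insert s C. c b \<odot>\<^bsub>A\<^esub> b) = \<zero>\<^bsub>A\<^esub>" and v: "v \<in> insert s C"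
      have c': "c \<in> C \<rightarrow> carrier F" "c s \<in> carrier F" using c by auto
      let ?y = "\<Oplus>\<^bsub>A\<^esub>b\<in>C. c b \<odot>\<^bsub>A\<^esub> b"
      have y: "?y \<in> lin_span F A B"
        using c' C(2) by (intro finsum_mem_submodule[OF span]) (auto intro: span_closed(4))
      have yA: "?y \<in> carrier A" using span_closed(1)[OF y] .
      have z: "c s \<odot>\<^bsub>A\<^esub> s \<oplus>\<^bsub>A\<^esub> ?y = \<zero>\<^bsub>A\<^esub>" using 0 sum_insert[OF c] by simp
      then have "c s \<odot>\<^bsub>A\<^esub> s = \<ominus>\<^bsub>A\<^esub> ?y" using c' sA yA by (simp add: M.minus_equality)
      then have "c s \<odot>\<^bsub>A\<^esub> s \<in> lin_span F A B" using y by (simp add: span_closed(3))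
      \<comment> \<open>A nonzero \<open>c s\<close> could be cancelled, which would put
        \<open>s\<close> into the span of \<open>B\<close>.\<close>
      then have cs: "c s = \<zero>" using submodule_smult_cancel[OF span c'(2) _ sA] s(2) by blast
      then have "?y = \<zero>\<^bsub>A\<^esub>" using z sA yA by simp
      then show "c v = \<zero>" using ind[OF c'(1)] cs v by auto
    next
      fix x assume "x \<in> S"
      then obtain d y where d: "d \<in> carrier F" and y: "y \<in> ?T" and x: "x = d \<odot>\<^bsub>A\<^esub> s \<oplus>\<^bsub>A\<^esub> y"
        using split by blast
      obtain c where c: "c \<in> C \<rightarrow> carrier F" "y = (\<Oplus>\<^bsub>A\<^esub>b\<in>C. c b \<odot>\<^bsub>A\<^esub> b)" using gen[OF y] by blast
      \<comment> \<open>As \<open>s\<close> is not in \<open>C\<close>, overriding \<open>c\<close>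
        at \<open>s\<close> leaves the sum over \<open>C\<close> unchanged.\<close>
      let ?c = "c(s := d)"
      have "?c \<in> insert s C \<rightarrow> carrier F" using c(1) d by auto
      moreover have "y = (\<Oplus>\<^bsub>A\<^esub>b\<in>C. ?c b \<odot>\<^bsub>A\<^esub> b)"
        unfolding c(2) using c(1) CA sC by (intro M.finsum_cong') (auto simp: Pi_iff)
      ultimately show "\<exists>c \<in> insert s C \<rightarrow> carrier F. x = (\<Oplus>\<^bsub>A\<^esub>b\<in>insert s C. c b \<odot>\<^bsub>A\<^esub> b)"
        using x sum_insert[of ?c] by (intro bexI[of _ ?c]) simp_all
    qed
    then show ?thesis by blast
  qed
qed

text \<open>Spanning sets survive linear maps, whereas independence does not, so later arguments
  work with the right side. A basis is recovered by applying \<open>submodule_finite_basis\<close>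
  to the whole carrier.\<close>

lemma finite_dimensional_iff:
  "finite_dimensional F A \<longleftrightarrow> (\<exists>B. finite B \<and> B \<subseteq> carrier A \<and> lin_span F A B = carrier A)"
proof
  assume "finite_dimensional F A"
  then obtain B where B: "is_finite_basis F A B" unfolding finite_dimensional_def by blast
  then have "finite B" "B \<subseteq> carrier A" unfolding is_finite_basis_def by blast+
  then show "\<exists>B. finite B \<and> B \<subseteq> carrier A \<and> lin_span F A B = carrier A"
    using lin_span_finite_basis[OF B] by blast
next
  assume "\<exists>B. finite B \<and> B \<subseteq> carrier A \<and> lin_span F A B = carrier A"
  then have "\<exists>C. is_finite_basis F (A\<lparr>carrier := carrier A\<rparr>) C"
    using submodule_finite_basis[OF _ _ carrier_is_submodule] by blast
  then show "finite_dimensional F A"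
    unfolding is_finite_basis_submodule_iff[OF carrier_is_submodule]
    unfolding finite_dimensional_def is_finite_basis_def .
qed

lemma finite_dimensional_submodule:
  assumes "finite_dimensional F A" "submodule S F A"
  shows "finite_dimensional F (A\<lparr>carrier := S\<rparr>)"
proof -
  obtain B where B: "finite B" "B \<subseteq> carrier A" "lin_span F A B = carrier A"
    using assms(1) unfolding finite_dimensional_iff by blast
  have "S \<subseteq> lin_span F A B" unfolding B(3) by (rule submoduleE(1)[OF assms(2)])
  then show ?thesis
    unfolding finite_dimensional_def by (rule submodule_finite_basis[OF B(1,2) assms(2)])
qed

end

section \<open>The CB property as an identity\<close>

context nonassoc_algebra
begin

lemma mult_zero_left:
  assumes "x \<in> carrier A"
  shows "\<zero>\<^bsub>A\<^esub> \<otimes>\<^bsub>A\<^esub> x = \<zero>\<^bsub>A\<^esub>"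
proof -
  \<comment> \<open>Zero is written as the scalar zero times itself, so that homogeneity pulls the
    scalar out.\<close>
  have "\<zero>\<^bsub>A\<^esub> \<otimes>\<^bsub>A\<^esub> x = (\<zero> \<odot>\<^bsub>A\<^esub> \<zero>\<^bsub>A\<^esub>) \<otimes>\<^bsub>A\<^esub> x" by simp
  also have "\<dots> = \<zero> \<odot>\<^bsub>A\<^esub> (\<zero>\<^bsub>A\<^esub> \<otimes>\<^bsub>A\<^esub> x)" using assms by (intro mult_smult_left) auto
  also have "\<dots> = \<zero>\<^bsub>A\<^esub>" using assms mult_closed by simp
  finally show ?thesis .
qed

text \<open>Polarization: expand the square of \<open>x + y\<close> and drop the squares of
  \<open>x\<close> and \<open>y\<close>.\<close>

lemma anticommutative_add:
  assumes "anticommutative A" "x \<in> carrier A" "y \<in> carrier A"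
  shows "x \<otimes>\<^bsub>A\<^esub> y \<oplus>\<^bsub>A\<^esub> y \<otimes>\<^bsub>A\<^esub> x = \<zero>\<^bsub>A\<^esub>"
proof -
  have sq: "z \<otimes>\<^bsub>A\<^esub> z = \<zero>\<^bsub>A\<^esub>" if "z \<in> carrier A" for z
    using assms(1) that unfolding anticommutative_def by blast
  have "\<zero>\<^bsub>A\<^esub> = (x \<oplus>\<^bsub>A\<^esub> y) \<otimes>\<^bsub>A\<^esub> (x \<oplus>\<^bsub>A\<^esub> y)" using assms by (simp add: sq)
  also have "\<dots> = (x \<otimes>\<^bsub>A\<^esub> x \<oplus>\<^bsub>A\<^esub> x \<otimes>\<^bsub>A\<^esub> y) \<oplus>\<^bsub>A\<^esub> (y \<otimes>\<^bsub>A\<^esub> x \<oplus>\<^bsub>A\<^esub> y \<otimes>\<^bsub>A\<^esub> y)"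
    using assms(2,3) by (simp add: mult_add_left mult_add_right mult_closed M.a_ac)
  also have "\<dots> = x \<otimes>\<^bsub>A\<^esub> y \<oplus>\<^bsub>A\<^esub> y \<otimes>\<^bsub>A\<^esub> x"
    using assms(2,3) by (simp add: mult_closed sq)
  finally show ?thesis by simp
qed

text \<open>
  The identity on the right passes to homomorphic images, unlike the implication that defines
  \<^const>\<open>CB_property\<close>.
\<close>

lemma CB_property_iff:
  assumes "anticommutative A"
  shows "CB_property A \<longleftrightarrow>
    (\<forall>x \<in> carrier A. \<forall>z \<in> carrier A. (x \<otimes>\<^bsub>A\<^esub> z) \<otimes>\<^bsub>A\<^esub> x = \<zero>\<^bsub>A\<^esub>)"
proof
  assume "CB_property A"
  then show "\<forall>x \<in> carrier A. \<forall>z \<in> carrier A. (x \<otimes>\<^bsub>A\<^esub> z) \<otimes>\<^bsub>A\<^esub> x = \<zero>\<^bsub>A\<^esub>"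
    using assms unfolding CB_property_def anticommutative_def by blast
next
  assume R: "\<forall>x \<in> carrier A. \<forall>z \<in> carrier A. (x \<otimes>\<^bsub>A\<^esub> z) \<otimes>\<^bsub>A\<^esub> x = \<zero>\<^bsub>A\<^esub>"
  \<comment> \<open>Polarization of the identity in its repeated variable, replacing
    \<open>x\<close> by \<open>x + y\<close>.\<close>
  have swap: "(x \<otimes>\<^bsub>A\<^esub> z) \<otimes>\<^bsub>A\<^esub> y \<oplus>\<^bsub>A\<^esub> (y \<otimes>\<^bsub>A\<^esub> z) \<otimes>\<^bsub>A\<^esub> x = \<zero>\<^bsub>A\<^esub>"
    if "x \<in> carrier A" "y \<in> carrier A" "z \<in> carrier A" for x y z
  proof -
    have "\<zero>\<^bsub>A\<^esub> = ((x \<oplus>\<^bsub>A\<^esub> y) \<otimes>\<^bsub>A\<^esub> z) \<otimes>\<^bsub>A\<^esub> (x \<oplus>\<^bsub>A\<^esub> y)" using R that by simp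
    also have "\<dots> = ((x \<otimes>\<^bsub>A\<^esub> z) \<otimes>\<^bsub>A\<^esub> x \<oplus>\<^bsub>A\<^esub> (x \<otimes>\<^bsub>A\<^esub> z) \<otimes>\<^bsub>A\<^esub> y) \<oplus>\<^bsub>A\<^esub>
        ((y \<otimes>\<^bsub>A\<^esub> z) \<otimes>\<^bsub>A\<^esub> x \<oplus>\<^bsub>A\<^esub> (y \<otimes>\<^bsub>A\<^esub> z) \<otimes>\<^bsub>A\<^esub> y)"
      using that by (simp add: mult_add_left mult_add_right mult_closed M.a_ac)
    also have "\<dots> = (x \<otimes>\<^bsub>A\<^esub> z) \<otimes>\<^bsub>A\<^esub> y \<oplus>\<^bsub>A\<^esub> (y \<otimes>\<^bsub>A\<^esub> z) \<otimes>\<^bsub>A\<^esub> x"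
      using that R by (simp add: mult_closed)
    finally show ?thesis by simp
  qed
  show "CB_property A"
    unfolding CB_property_def
  proof (intro ballI impI)
    fix x y z
    assume c: "x \<in> carrier A" "y \<in> carrier A" "z \<in> carrier A" and xy: "x \<otimes>\<^bsub>A\<^esub> y = \<zero>\<^bsub>A\<^esub>"
    \<comment> \<open>Here \<open>swap\<close> reads \<open>(z y) x + (x y) z = 0\<close>, and the
      second summand vanishes because \<open>x y = 0\<close>.\<close>
    have zyx: "(z \<otimes>\<^bsub>A\<^esub> y) \<otimes>\<^bsub>A\<^esub> x = \<zero>\<^bsub>A\<^esub>"
      using swap[of z x y] c xy by (simp add: mult_zero_left mult_closed)
    have "(y \<otimes>\<^bsub>A\<^esub> z \<oplus>\<^bsub>A\<^esub> z \<otimes>\<^bsub>A\<^esub> y) \<otimes>\<^bsub>A\<^esub> x = \<zero>\<^bsub>A\<^esub>"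
      using anticommutative_add[OF assms] c by (simp add: mult_zero_left)
    then have "(y \<otimes>\<^bsub>A\<^esub> z) \<otimes>\<^bsub>A\<^esub> x = \<zero>\<^bsub>A\<^esub>"
      using c zyx by (simp add: mult_add_left mult_closed)
    \<comment> \<open>\<open>swap\<close> pairs the goal with \<open>(y z) x\<close>, which is now
      known to be zero.\<close>
    then show "(x \<otimes>\<^bsub>A\<^esub> z) \<otimes>\<^bsub>A\<^esub> y = \<zero>\<^bsub>A\<^esub>"
      using swap[of x y z] c by (simp add: mult_closed)
  qed
qed

end

section \<open>Subalgebras\<close>

text \<open>The laws and the CB implication quantify over carrier elements and keep the same
  operations, so they restrict to \<open>S\<close>; finite dimension comes from
  \<open>finite_dimensional_submodule\<close>.\<close>

lemma fd_CB_algebra_subalgebra: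
  assumes "fd_CB_algebra F A" "nonassoc_subalgebra S F A"
  shows "fd_CB_algebra F (A\<lparr>carrier := S\<rparr>)"
proof -
  interpret nonassoc_algebra F A using assms(1) by (simp add: fd_CB_algebra_def)
  have S: "submodule S F A" and cl: "\<And>x y. x \<in> S \<Longrightarrow> y \<in> S \<Longrightarrow> x \<otimes>\<^bsub>A\<^esub> y \<in> S"
    using assms(2) by (auto simp: nonassoc_subalgebra_def)
  note SA = submodule_closed(1)[OF S]
  have "nonassoc_algebra F (A\<lparr>carrier := S\<rparr>)"
    using field_axioms submodule.submodule_is_module[OF S module_axioms]
    by (intro nonassoc_algebra.intro nonassoc_algebra_axioms.intro)
      (auto simp: SA cl mult_add_left mult_add_right mult_smult_left mult_smult_right)
  then show ?thesis
    using assms(1) finite_dimensional_submodule[OF _ S] SA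
    by (auto simp: fd_CB_algebra_def anticommutative_def CB_property_def)
qed

section \<open>Homomorphic images and factor algebras\<close>

lemma finite_dimensional_image:
  assumes "linear_space F A" "linear_space F Q" "finite_dimensional F A"
    and surj: "h ` carrier A = carrier Q"
    and add: "\<And>x y. \<lbrakk>x \<in> carrier A; y \<in> carrier A\<rbrakk> \<Longrightarrow> h (x \<oplus>\<^bsub>A\<^esub> y) = h x \<oplus>\<^bsub>Q\<^esub> h y"
    and smult: "\<And>a x. \<lbrakk>a \<in> carrier F; x \<in> carrier A\<rbrakk> \<Longrightarrow> h (a \<odot>\<^bsub>A\<^esub> x) = a \<odot>\<^bsub>Q\<^esub> h x"
  shows "finite_dimensional F Q"
proof -
  interpret A: linear_space F A by fact
  interpret Q: linear_space F Q by fact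
  obtain B where B: "finite B" "B \<subseteq> carrier A" "lin_span F A B = carrier A"
    using assms(3) unfolding A.finite_dimensional_iff by blast
  have hc: "h x \<in> carrier Q" if "x \<in> carrier A" for x using surj that by blast
  have zero: "h \<zero>\<^bsub>A\<^esub> = \<zero>\<^bsub>Q\<^esub>"
    using smult[of "\<zero>\<^bsub>F\<^esub>" "\<zero>\<^bsub>A\<^esub>"] hc[of "\<zero>\<^bsub>A\<^esub>"] by simp
  have hB: "h ` B \<subseteq> carrier Q" using B(2) hc by blast
  note span = Q.submodule_closed[OF Q.submodule_lin_span[OF hB]]
  have "submodule {x \<in> carrier A. h x \<in> lin_span F Q (h ` B)} F A"
    by (rule A.submoduleI_smult) (auto simp: zero add smult span)
  then have "lin_span F A B \<subseteq> {x \<in> carrier A. h x \<in> lin_span F Q (h ` B)}"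
    using B(2) Q.lin_span_superset[of "h ` B"] by (intro A.lin_span_least) auto
  then have "carrier Q \<subseteq> lin_span F Q (h ` B)" unfolding B(3) surj[symmetric] by blast
  then have "lin_span F Q (h ` B) = carrier Q"
    using Q.submoduleE(1)[OF Q.submodule_lin_span[OF hB]] by blast
  then show ?thesis
    unfolding Q.finite_dimensional_iff using B(1) hB by (intro exI[of _ "h ` B"]) simp
qed

text \<open>\<open>Q\<close> is only a record here; every law, including those of an abelian group,
  is transported from \<open>A\<close> along the surjection \<open>h\<close>. Preservation of zero
  is therefore a separate hypothesis.\<close>

lemma fd_CB_algebra_image:
  fixes A :: "('f, 'a, 'n) module_scheme" and Q :: "('f, 'b, 'k) module_scheme"
  assumes "fd_CB_algebra F A"
    and surj: "h ` carrier A = carrier Q"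
    and zero: "h \<zero>\<^bsub>A\<^esub> = \<zero>\<^bsub>Q\<^esub>"
    and add: "\<And>x y. \<lbrakk>x \<in> carrier A; y \<in> carrier A\<rbrakk> \<Longrightarrow> h (x \<oplus>\<^bsub>A\<^esub> y) = h x \<oplus>\<^bsub>Q\<^esub> h y"
    and mult: "\<And>x y. \<lbrakk>x \<in> carrier A; y \<in> carrier A\<rbrakk> \<Longrightarrow> h (x \<otimes>\<^bsub>A\<^esub> y) = h x \<otimes>\<^bsub>Q\<^esub> h y"
    and smult: "\<And>a x. \<lbrakk>a \<in> carrier F; x \<in> carrier A\<rbrakk> \<Longrightarrow> h (a \<odot>\<^bsub>A\<^esub> x) = a \<odot>\<^bsub>Q\<^esub> h x"
  shows "fd_CB_algebra F Q"
proof -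
  interpret nonassoc_algebra F A using assms(1) by (simp add: fd_CB_algebra_def)
  \<comment> \<open>Read from right to left, these equations turn elements of \<open>Q\<close> into
    values of \<open>h\<close> and gather each term of \<open>Q\<close> into \<open>h\<close> of a
    term of \<open>A\<close>.\<close>
  note simps = surj[symmetric] zero[symmetric] add[symmetric] mult[symmetric] smult[symmetric]
  have group: "abelian_group Q"
  proof (rule abelian_groupI)
    fix X assume "X \<in> carrier Q"
    then obtain x where x: "x \<in> carrier A" "X = h x" using surj by blast
    then have "h (\<ominus>\<^bsub>A\<^esub> x) \<oplus>\<^bsub>Q\<^esub> X = \<zero>\<^bsub>Q\<^esub>" by (simp add: simps M.l_neg)
    then show "\<exists>Y\<in>carrier Q. Y \<oplus>\<^bsub>Q\<^esub> X = \<zero>\<^bsub>Q\<^esub>" using x surj by blast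
  qed (auto simp: simps M.a_ac)
  have "module F Q"
    by (rule moduleI[OF is_cring group]) (auto simp: simps smult_l_distr smult_r_distr smult_assoc1)
  then have alg: "nonassoc_algebra F Q"
    using field_axioms
    by (intro nonassoc_algebra.intro nonassoc_algebra_axioms.intro)
      (auto simp: simps mult_closed mult_add_left mult_add_right mult_smult_left mult_smult_right)
  interpret Q: nonassoc_algebra F Q by (rule alg)
  have "finite_dimensional F A" using assms(1) by (simp add: fd_CB_algebra_def)
  then have "finite_dimensional F Q"
    by (rule finite_dimensional_image[OF linear_space_axioms Q.linear_space_axioms _ surj add smult])
  moreover have anti: "anticommutative Q"
    using assms(1) by (auto simp: fd_CB_algebra_def anticommutative_def simps)
  \<comment> \<open>A vanishing product in \<open>Q\<close> need not lift to one in
    \<open>A\<close>, so the identity is transported instead of the implication.\<close>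
  moreover have "CB_property Q"
    using assms(1) unfolding Q.CB_property_iff[OF anti] fd_CB_algebra_def
    by (auto simp: CB_property_iff simps mult_closed)
  ultimately show ?thesis using alg by (simp add: fd_CB_algebra_def)
qed

text \<open>The factor algebra is the image of \<open>A\<close> under the projection to cosets. What
  has to be shown is that the coset operations do not depend on representatives.\<close>

lemma fd_CB_algebra_factor:
  assumes "fd_CB_algebra F A" "nonassoc_ideal I F A"
  shows "fd_CB_algebra F (factor_algebra A I)"
proof -
  interpret nonassoc_algebra F A using assms(1) by (simp add: fd_CB_algebra_def)
  have I: "submodule I F A"
    and l: "\<And>x u. x \<in> carrier A \<Longrightarrow> u \<in> I \<Longrightarrow> x \<otimes>\<^bsub>A\<^esub> u \<in> I"
    and r: "\<And>x u. x \<in> carrier A \<Longrightarrow> u \<in> I \<Longrightarrow> u \<otimes>\<^bsub>A\<^esub> x \<in> I"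
    using assms(2) by (auto simp: nonassoc_ideal_def)
  note cl = submodule_closed[OF I]
  have sub: "subgroup I (add_monoid A)" using I by (rule submodule.axioms(1))
  \<comment> \<open>Addition in \<open>A\<close> is commutative, so \<open>I\<close> is normal; this
    supplies the sum of cosets.\<close>
  interpret I: abelian_subgroup I A
    using sub M.a_comm_group by (intro abelian_subgroupI2)
  have coset: "X \<in> I +>\<^bsub>A\<^esub> x \<longleftrightarrow> (\<exists>i\<in>I. X = i \<oplus>\<^bsub>A\<^esub> x)" for X x
    by (auto simp: a_r_coset_def')
  have shift: "I +>\<^bsub>A\<^esub> (i \<oplus>\<^bsub>A\<^esub> x) = I +>\<^bsub>A\<^esub> x" if "i \<in> I" "x \<in> carrier A" for i x
    using M.a_repr_independence[OF _ that(2) sub, of "i \<oplus>\<^bsub>A\<^esub> x"] that coset by blast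
  \<comment> \<open>Products and scalar multiples of cosets are unions over representatives. All
    members of such a union agree, and a nonempty index set lets it collapse to one coset.\<close>
  have nonempty: "I +>\<^bsub>A\<^esub> x \<noteq> {}" for x using cl(2) coset by blast
  have mult: "I +>\<^bsub>A\<^esub> (x \<otimes>\<^bsub>A\<^esub> y) = rcoset_mult A I (I +>\<^bsub>A\<^esub> x) (I +>\<^bsub>A\<^esub> y)"
    if c: "x \<in> carrier A" "y \<in> carrier A" for x y
  proof -
    have "I +>\<^bsub>A\<^esub> (a \<otimes>\<^bsub>A\<^esub> b) = I +>\<^bsub>A\<^esub> (x \<otimes>\<^bsub>A\<^esub> y)"
      if ab: "a \<in> I +>\<^bsub>A\<^esub> x" "b \<in> I +>\<^bsub>A\<^esub> y" for a b
    proof -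
      obtain i j where ij: "i \<in> I" "j \<in> I" "a = i \<oplus>\<^bsub>A\<^esub> x" "b = j \<oplus>\<^bsub>A\<^esub> y"
        using ab unfolding coset by blast
      have iA: "i \<in> carrier A" "j \<in> carrier A" using ij(1,2) by (auto intro: cl(1))
      \<comment> \<open>Every term other than \<open>x y\<close> has a factor in \<open>I\<close>,
        so the ideal absorbs it.\<close>
      have "a \<otimes>\<^bsub>A\<^esub> b = (i \<otimes>\<^bsub>A\<^esub> j \<oplus>\<^bsub>A\<^esub> i \<otimes>\<^bsub>A\<^esub> y \<oplus>\<^bsub>A\<^esub> x \<otimes>\<^bsub>A\<^esub> j) \<oplus>\<^bsub>A\<^esub> x \<otimes>\<^bsub>A\<^esub> y"
        using c iA by (simp add: ij mult_add_left mult_add_right mult_closed M.a_ac)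
      moreover have "i \<otimes>\<^bsub>A\<^esub> j \<oplus>\<^bsub>A\<^esub> i \<otimes>\<^bsub>A\<^esub> y \<oplus>\<^bsub>A\<^esub> x \<otimes>\<^bsub>A\<^esub> j \<in> I"
        using c iA ij by (intro cl(5) l r)
      ultimately show ?thesis using shift c mult_closed by simp
    qed
    then show ?thesis using nonempty unfolding rcoset_mult_def by simp
  qed
  have smult: "I +>\<^bsub>A\<^esub> (a \<odot>\<^bsub>A\<^esub> x) = (\<Union>z\<in>I +>\<^bsub>A\<^esub> x. I +>\<^bsub>A\<^esub> (a \<odot>\<^bsub>A\<^esub> z))"
    if c: "a \<in> carrier F" "x \<in> carrier A" for a x
  proof -
    have "I +>\<^bsub>A\<^esub> (a \<odot>\<^bsub>A\<^esub> z) = I +>\<^bsub>A\<^esub> (a \<odot>\<^bsub>A\<^esub> x)" if z: "z \<in> I +>\<^bsub>A\<^esub> x" for z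
    proof -
      obtain i where i: "i \<in> I" "z = i \<oplus>\<^bsub>A\<^esub> x" using z coset by blast
      then show ?thesis using c cl(1) cl(4)[OF c(1)] shift by (simp add: smult_r_distr)
    qed
    then show ?thesis using nonempty by simp
  qed
  show ?thesis
  proof (rule fd_CB_algebra_image[OF assms(1), of "\<lambda>x. I +>\<^bsub>A\<^esub> x"])
    show "(\<lambda>x. I +>\<^bsub>A\<^esub> x) ` carrier A = carrier (factor_algebra A I)"
      by (auto simp: factor_algebra_def A_RCOSETS_def')
    show "I +>\<^bsub>A\<^esub> \<zero>\<^bsub>A\<^esub> = \<zero>\<^bsub>factor_algebra A I\<^esub>"
      using submoduleE(1)[OF I] by (simp add: factor_algebra_def)
  qed (simp_all add: factor_algebra_def I.a_rcos_sum mult smult)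
qed

section \<open>Direct sums\<close>

text \<open>All laws hold coordinate by coordinate, and the embedded spanning sets of the summands
  together span. The hypothesis \<open>field F\<close> covers empty \<open>J\<close>, where no
  summand provides it.\<close>

lemma fd_CB_algebra_direct_sum:
  assumes "field F" "finite J" "\<And>i. i \<in> J \<Longrightarrow> fd_CB_algebra F (A i)"
  shows "fd_CB_algebra F (direct_sum_algebra J A)"
proof -
  let ?D = "direct_sum_algebra J A"
  interpret F: field F by fact
  have alg: "nonassoc_algebra F (A i)" if "i \<in> J" for i
    using assms(3)[OF that] by (simp add: fd_CB_algebra_def)
  have mod: "module F (A i)" and lin: "linear_space F (A i)" if "i \<in> J" for i
    using nonassoc_algebra.axioms(2)[OF alg[OF that]] assms(1) by (auto intro: linear_space.intro)
  have grp: "abelian_group (A i)" if "i \<in> J" for i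
    using module.axioms(2)[OF mod[OF that]] .
  have mon: "abelian_monoid (A i)" if "i \<in> J" for i
    using abelian_group.axioms(1)[OF grp[OF that]] .
  have sel: "x i \<in> carrier (A i)" if "x \<in> (\<Pi>\<^sub>E i\<in>J. carrier (A i))" "i \<in> J" for x i
    using that by auto
  note ops = abelian_monoid.a_closed[OF mon] abelian_monoid.zero_closed[OF mon]
    module.smult_closed[OF mod] abelian_group.a_inv_closed[OF grp]
    nonassoc_algebra.mult_closed[OF alg]
  note D_def = direct_sum_algebra_def
  have group: "abelian_group ?D"
  proof (rule abelian_groupI)
    fix x assume x: "x \<in> carrier ?D"
    then have "(\<lambda>i\<in>J. \<ominus>\<^bsub>A i\<^esub> x i) \<in> carrier ?D"
      by (auto simp: D_def ops sel)
    moreover have "(\<lambda>i\<in>J. \<ominus>\<^bsub>A i\<^esub> x i) \<oplus>\<^bsub>?D\<^esub> x = \<zero>\<^bsub>?D\<^esub>"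
      using x by (auto simp: D_def abelian_group.l_neg[OF grp] sel intro!: restrict_ext)
    ultimately show "\<exists>y\<in>carrier ?D. y \<oplus>\<^bsub>?D\<^esub> x = \<zero>\<^bsub>?D\<^esub>" by blast
  next
    fix x assume "x \<in> carrier ?D"
    \<comment> \<open>The right side is \<open>x\<close> itself and not a restriction, so agreement
      outside \<open>J\<close> rests on \<open>x\<close> being extensional.\<close>
    then show "\<zero>\<^bsub>?D\<^esub> \<oplus>\<^bsub>?D\<^esub> x = x"
      by (auto simp: D_def abelian_monoid.l_zero[OF mon] PiE_iff intro!: extensionalityI[of _ J])
  qed (auto simp: D_def ops sel abelian_monoid.a_assoc[OF mon] abelian_monoid.a_comm[OF mon]
        abelian_monoid.a_lcomm[OF mon] intro!: restrict_ext)
  have module: "module F ?D"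
  proof (rule moduleI[OF F.is_cring group])
    fix x assume "x \<in> carrier ?D"
    then show "\<one>\<^bsub>F\<^esub> \<odot>\<^bsub>?D\<^esub> x = x"
      by (auto simp: D_def module.smult_one[OF mod] PiE_iff intro!: extensionalityI[of _ J])
  qed (auto simp: D_def ops sel module.smult_l_distr[OF mod] module.smult_r_distr[OF mod]
        module.smult_assoc1[OF mod] intro!: restrict_ext)
  have algD: "nonassoc_algebra F ?D"
    using assms(1) module
    by (intro nonassoc_algebra.intro nonassoc_algebra_axioms.intro)
      (auto simp: D_def ops sel nonassoc_algebra.mult_add_left[OF alg]
        nonassoc_algebra.mult_add_right[OF alg] nonassoc_algebra.mult_smult_left[OF alg]
        nonassoc_algebra.mult_smult_right[OF alg] intro!: restrict_ext)
  interpret D: nonassoc_algebra F ?D by (rule algD)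
  have anti: "anticommutative ?D"
    using assms(3)
    by (auto simp: anticommutative_def D_def sel fd_CB_algebra_def intro!: restrict_ext)
  have "CB_property ?D"
    unfolding D.CB_property_iff[OF anti]
  proof (intro ballI)
    fix x z assume c: "x \<in> carrier ?D" "z \<in> carrier ?D"
    have "(x i \<otimes>\<^bsub>A i\<^esub> z i) \<otimes>\<^bsub>A i\<^esub> x i = \<zero>\<^bsub>A i\<^esub>" if i: "i \<in> J" for i
      using nonassoc_algebra.CB_property_iff[OF alg[OF i]] assms(3)[OF i] i c sel
      by (auto simp: fd_CB_algebra_def D_def)
    then show "(x \<otimes>\<^bsub>?D\<^esub> z) \<otimes>\<^bsub>?D\<^esub> x = \<zero>\<^bsub>?D\<^esub>"
      by (auto simp: D_def intro!: restrict_ext)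
  qed
  moreover have "finite_dimensional F ?D"
  proof -
    \<comment> \<open>\<open>e i\<close> embeds the summand \<open>A i\<close>: \<open>a\<close> in
      coordinate \<open>i\<close>, zero in the others.\<close>
    define e where "e i a = (\<lambda>j\<in>J. if j = i then a else \<zero>\<^bsub>A j\<^esub>)" for i a
    have "\<forall>i\<in>J. \<exists>B. finite B \<and> B \<subseteq> carrier (A i) \<and> lin_span F (A i) B = carrier (A i)"
      using assms(3) linear_space.finite_dimensional_iff[OF lin] by (auto simp: fd_CB_algebra_def)
    then obtain B where B: "\<And>i. i \<in> J \<Longrightarrow> finite (B i)" "\<And>i. i \<in> J \<Longrightarrow> B i \<subseteq> carrier (A i)"
        "\<And>i. i \<in> J \<Longrightarrow> lin_span F (A i) (B i) = carrier (A i)"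
      by metis
    let ?G = "\<Union>i\<in>J. e i ` B i"
    have e_closed: "e i a \<in> carrier ?D" if "i \<in> J" "a \<in> carrier (A i)" for i a
      using that ops by (auto simp: e_def D_def)
    have G: "finite ?G" "?G \<subseteq> carrier ?D"
      using assms(2) B(1,2) e_closed by blast+
    note span = D.submodule_closed[OF D.submodule_lin_span[OF G(2)]]
    have e_zero: "e i \<zero>\<^bsub>A i\<^esub> = \<zero>\<^bsub>?D\<^esub>" for i
      by (auto simp: e_def D_def intro!: restrict_ext)
    have e_add: "e i (a \<oplus>\<^bsub>A i\<^esub> b) = e i a \<oplus>\<^bsub>?D\<^esub> e i b"
      if "i \<in> J" "a \<in> carrier (A i)" "b \<in> carrier (A i)" for i a b
      using that ops(2) by (auto simp: e_def D_def abelian_monoid.l_zero[OF mon] intro!: restrict_ext)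
    have e_smult: "e i (c \<odot>\<^bsub>A i\<^esub> a) = c \<odot>\<^bsub>?D\<^esub> e i a"
      if "i \<in> J" "c \<in> carrier F" "a \<in> carrier (A i)" for i c a
      using that by (auto simp: e_def D_def module.smult_r_null[OF mod] intro!: restrict_ext)
    \<comment> \<open>The preimage of the span under \<open>e i\<close> is a submodule of
      \<open>A i\<close> containing \<open>B i\<close>, hence everything.\<close>
    have e_span: "e i a \<in> lin_span F ?D ?G" if i: "i \<in> J" and a: "a \<in> carrier (A i)" for i a
    proof -
      interpret Ai: linear_space F "A i" by (rule lin[OF i])
      have "submodule {a \<in> carrier (A i). e i a \<in> lin_span F ?D ?G} F (A i)"
        by (rule Ai.submoduleI_smult) (auto simp: e_zero e_add e_smult i span)
      then have "lin_span F (A i) (B i) \<subseteq> {a \<in> carrier (A i). e i a \<in> lin_span F ?D ?G}"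
        using B(2)[OF i] i D.lin_span_superset[of ?G] by (intro Ai.lin_span_least) auto
      then show ?thesis using B(3)[OF i] a by blast
    qed
    have "carrier ?D \<subseteq> lin_span F ?D ?G"
    proof
      fix x assume x: "x \<in> carrier ?D"
      \<comment> \<open>Truncations of \<open>x\<close> are built up one coordinate at a time,
        starting from zero; \<open>K = J\<close> gives back \<open>x\<close>.\<close>
      have part: "(\<lambda>j\<in>J. if j \<in> K then x j else \<zero>\<^bsub>A j\<^esub>) \<in> lin_span F ?D ?G" if "K \<subseteq> J" for K
        using finite_subset[OF that assms(2)] that
      proof (induction K)
        case empty
        have "(\<lambda>j\<in>J. if j \<in> {} then x j else \<zero>\<^bsub>A j\<^esub>) = \<zero>\<^bsub>?D\<^esub>"
          by (simp add: D_def restrict_def)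
        then show ?case by (simp only: span(2))
      next
        case (insert k K)
        have k: "k \<in> J" "x k \<in> carrier (A k)" using insert.prems x by (auto simp: D_def)
        have "(\<lambda>j\<in>J. if j \<in> insert k K then x j else \<zero>\<^bsub>A j\<^esub>) =
            e k (x k) \<oplus>\<^bsub>?D\<^esub> (\<lambda>j\<in>J. if j \<in> K then x j else \<zero>\<^bsub>A j\<^esub>)"
          using insert.hyps x ops(2)
          by (auto simp: e_def D_def sel abelian_monoid.l_zero[OF mon] abelian_monoid.r_zero[OF mon]
              intro!: restrict_ext)
        moreover have "e k (x k) \<oplus>\<^bsub>?D\<^esub> (\<lambda>j\<in>J. if j \<in> K then x j else \<zero>\<^bsub>A j\<^esub>) \<in> lin_span F ?D ?G"
          using insert.prems by (intro span(5) e_span k insert.IH) blast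
        ultimately show ?case by (simp only:)
      qed
      have "(\<lambda>j\<in>J. if j \<in> J then x j else \<zero>\<^bsub>A j\<^esub>) = restrict x J"
        by (rule restrict_ext) simp
      also have "\<dots> = x" using x by (simp add: D_def PiE_restrict)
      finally show "x \<in> lin_span F ?D ?G" using part[OF order_refl] by (simp only:)
    qed
    then have "lin_span F ?D ?G = carrier ?D"
      using D.submoduleE(1)[OF D.submodule_lin_span[OF G(2)]] by blast
    then show ?thesis
      unfolding D.finite_dimensional_iff using G by (intro exI[of _ ?G]) simp
  qed
  ultimately show ?thesis using algD anti by (simp add: fd_CB_algebra_def)
qed

text \<open>Two summands with different element types do not form a family, so the componentwise
  argument is carried out on pairs.\<close>

lemma fd_CB_algebra_direct_sum2:
  assumes "fd_CB_algebra F A" "fd_CB_algebra F B"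
  shows "fd_CB_algebra F (direct_sum2_algebra A B)"
proof -
  let ?D = "direct_sum2_algebra A B"
  interpret A: nonassoc_algebra F A using assms(1) by (simp add: fd_CB_algebra_def)
  interpret B: nonassoc_algebra F B using assms(2) by (simp add: fd_CB_algebra_def)
  note D_def = direct_sum2_algebra_def
  have group: "abelian_group ?D"
  proof (rule abelian_groupI)
    fix x assume x: "x \<in> carrier ?D"
    show "\<exists>y\<in>carrier ?D. y \<oplus>\<^bsub>?D\<^esub> x = \<zero>\<^bsub>?D\<^esub>"
      using x
      by (intro bexI[of _ "(\<ominus>\<^bsub>A\<^esub> fst x, \<ominus>\<^bsub>B\<^esub> snd x)"]) (auto simp: D_def A.M.l_neg B.M.l_neg)
  qed (auto simp: D_def A.M.a_ac B.M.a_ac)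
  have module: "module F ?D"
    by (rule moduleI[OF A.is_cring group])
      (auto simp: D_def A.smult_l_distr A.smult_r_distr A.smult_assoc1
        B.smult_l_distr B.smult_r_distr B.smult_assoc1)
  have algD: "nonassoc_algebra F ?D"
    using A.field_axioms module
    by (intro nonassoc_algebra.intro nonassoc_algebra_axioms.intro)
      (auto simp: D_def A.mult_closed A.mult_add_left A.mult_add_right A.mult_smult_left
        A.mult_smult_right B.mult_closed B.mult_add_left B.mult_add_right B.mult_smult_left
        B.mult_smult_right)
  interpret D: nonassoc_algebra F ?D by (rule algD)
  have "finite_dimensional F ?D"
  proof -
    obtain X where X: "finite X" "X \<subseteq> carrier A" "lin_span F A X = carrier A"
      using assms(1) unfolding fd_CB_algebra_def A.finite_dimensional_iff by blast
    obtain Y where Y: "finite Y" "Y \<subseteq> carrier B" "lin_span F B Y = carrier B"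
      using assms(2) unfolding fd_CB_algebra_def B.finite_dimensional_iff by blast
    let ?G = "(\<lambda>x. (x, \<zero>\<^bsub>B\<^esub>)) ` X \<union> (\<lambda>y. (\<zero>\<^bsub>A\<^esub>, y)) ` Y"
    have G: "finite ?G" "?G \<subseteq> carrier ?D" using X Y by (auto simp: D_def)
    note span = D.submodule_closed[OF D.submodule_lin_span[OF G(2)]]
    \<comment> \<open>Closure of the span is restated on explicit pairs, to match the operations of
      the two factors.\<close>
    have zero: "(\<zero>\<^bsub>A\<^esub>, \<zero>\<^bsub>B\<^esub>) \<in> lin_span F ?D ?G" using span(2) by (simp add: D_def)
    have add: "(a \<oplus>\<^bsub>A\<^esub> a', b \<oplus>\<^bsub>B\<^esub> b') \<in> lin_span F ?D ?G"
      if "(a, b) \<in> lin_span F ?D ?G" "(a', b') \<in> lin_span F ?D ?G" for a a' b b'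
      using span(5)[OF that] by (simp add: D_def)
    have smult: "(c \<odot>\<^bsub>A\<^esub> a, c \<odot>\<^bsub>B\<^esub> b) \<in> lin_span F ?D ?G"
      if "c \<in> carrier F" "(a, b) \<in> lin_span F ?D ?G" for a b c
      using span(4)[OF that] by (simp add: D_def)
    have "submodule {a \<in> carrier A. (a, \<zero>\<^bsub>B\<^esub>) \<in> lin_span F ?D ?G} F A"
      using add[of _ "\<zero>\<^bsub>B\<^esub>" _ "\<zero>\<^bsub>B\<^esub>"] smult[of _ _ "\<zero>\<^bsub>B\<^esub>"]
      by (intro A.submoduleI_smult) (auto simp: zero)
    then have "lin_span F A X \<subseteq> {a \<in> carrier A. (a, \<zero>\<^bsub>B\<^esub>) \<in> lin_span F ?D ?G}"
      using X(2) D.lin_span_superset[of ?G] by (intro A.lin_span_least) auto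
    moreover have "submodule {b \<in> carrier B. (\<zero>\<^bsub>A\<^esub>, b) \<in> lin_span F ?D ?G} F B"
      using add[of "\<zero>\<^bsub>A\<^esub>" _ "\<zero>\<^bsub>A\<^esub>"] smult[of _ "\<zero>\<^bsub>A\<^esub>"]
      by (intro B.submoduleI_smult) (auto simp: zero)
    then have "lin_span F B Y \<subseteq> {b \<in> carrier B. (\<zero>\<^bsub>A\<^esub>, b) \<in> lin_span F ?D ?G}"
      using Y(2) D.lin_span_superset[of ?G] by (intro B.lin_span_least) auto
    \<comment> \<open>Each pair splits as \<open>(a, 0) + (0, b)\<close>, with both summands already
      in the span.\<close>
    ultimately have "(a, b) \<in> lin_span F ?D ?G" if "a \<in> carrier A" "b \<in> carrier B" for a b
      using add[of a "\<zero>\<^bsub>B\<^esub>" "\<zero>\<^bsub>A\<^esub>" b] that X(3) Y(3) by auto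
    then have "carrier ?D \<subseteq> lin_span F ?D ?G" by (auto simp: D_def)
    then have "lin_span F ?D ?G = carrier ?D"
      using D.submoduleE(1)[OF D.submodule_lin_span[OF G(2)]] by blast
    then show ?thesis
      unfolding D.finite_dimensional_iff using G by (intro exI[of _ ?G]) simp
  qed
  moreover have anti: "anticommutative ?D"
    using assms by (auto simp: anticommutative_def D_def fd_CB_algebra_def)
  \<comment> \<open>A product of pairs is zero exactly when both components are, so the implication
    passes over directly.\<close>
  moreover have "CB_property ?D"
    using assms unfolding fd_CB_algebra_def CB_property_def by (auto simp: D_def)
  ultimately show ?thesis using algD by (simp add: fd_CB_algebra_def)
qed

theorem corollary3p8:
  fixes F :: "'f ring"
  assumes "field F"
  shows "(\<forall>(A :: ('f, 'a) module) S.
            fd_CB_algebra F A \<and> nonassoc_subalgebra S F A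
              \<longrightarrow> fd_CB_algebra F (A\<lparr>carrier := S\<rparr>)) \<and>
         (\<forall>(A :: ('f, 'a) module) I.
            fd_CB_algebra F A \<and> nonassoc_ideal I F A
              \<longrightarrow> fd_CB_algebra F (factor_algebra A I)) \<and>
         (\<forall>(J :: 'i set) (A :: 'i \<Rightarrow> ('f, 'a) module).
            finite J \<and> (\<forall>i\<in>J. fd_CB_algebra F (A i))
              \<longrightarrow> fd_CB_algebra F (direct_sum_algebra J A)) \<and>
         (\<forall>(A :: ('f, 'a) module) (B :: ('f, 'b) module).
            fd_CB_algebra F A \<and> fd_CB_algebra F B
              \<longrightarrow> fd_CB_algebra F (direct_sum2_algebra A B))"
proof (intro conjI allI impI; elim conjE)
  show "fd_CB_algebra F (A\<lparr>carrier := S\<rparr>)"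
    if "fd_CB_algebra F A" "nonassoc_subalgebra S F A" for A :: "('f, 'a) module" and S
    using that by (rule fd_CB_algebra_subalgebra)
  show "fd_CB_algebra F (factor_algebra A I)"
    if "fd_CB_algebra F A" "nonassoc_ideal I F A" for A :: "('f, 'a) module" and I
    using that by (rule fd_CB_algebra_factor)
  show "fd_CB_algebra F (direct_sum_algebra J A)"
    if "finite J" "\<forall>i\<in>J. fd_CB_algebra F (A i)"
    for J :: "'i set" and A :: "'i \<Rightarrow> ('f, 'a) module"
    using assms that(1) that(2)[rule_format] by (rule fd_CB_algebra_direct_sum)
  show "fd_CB_algebra F (direct_sum2_algebra A B)"
    if "fd_CB_algebra F A" "fd_CB_algebra F B"
    for A :: "('f, 'a) module" and B :: "('f, 'b) module"
    using that by (rule fd_CB_algebra_direct_sum2)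
qed

end
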